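(* Let $a_n$ ($n\in\mathbb{Z}$) and $b_m$ ($m\in\mathbb{Z}$) be non-zero real numbers with $a_n\ne b_m$ for all $n,m$, and let $\lambda$ be a non-zero real constant with $1/\lambda\neq a_n$, $1/\lambda\ne b_m$ for all $n,m$. Let $\gamma_n^m$ be a discrete motion of a discrete curve with potential function $\Theta_n^m$. Let $\overline\Theta{}_n^m$ be a real function on $\mathbb{Z}^2$ satisfying $$\tan\left(\frac{\overline\Theta{}_{n+1}^m+\Theta_n^m}{4}\right)=\frac{\frac1\lambda+a_n}{\frac1\lambda-a_n}\tan\left(\frac{\overline\Theta{}_n^m+\Theta_{n+1}^m}{4}\right),$$ $$\tan\left(\frac{\overline\Theta{}_n^{m+1}+\Theta_n^m}{4}\right)=\frac{\frac1\lambda+b_m}{\frac1\lambda-b_m}\tan\left(\frac{\overline\Theta{}_n^m+\Theta_n^{m+1}}{4}\right).$$ Then $$\overline\gamma{}_n^m=S\left[\gamma_n^m+\frac1\lambda\,R\left(-\frac{\overline\Theta{}_n^m+\Theta_{n+1}^m}{2}\right)\frac{\gamma_{n+1}^m-\gamma_n^m}{a_n}\right],\qquad S=\begin{bmatrix}1&0\\0&-1\end{bmatrix},$$ is a discrete motion of a discrete curve with potential function $\overline\Theta{}_n^m$.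
   Context: The bars are names of new real objects, not complex conjugates. $R(\phi)=\begin{pmatrix}\cos\phi&-\sin\phi\\ \sin\phi&\cos\phi\end{pmatrix}$. A map $\gamma:\mathbb{Z}^2\to\mathbb{R}^2$, $(n,m)\mapsto\gamma_n^m$, is a discrete motion of a discrete curve (with respect to $a_n,b_m$) with potential function $\Theta_n^m\in\mathbb{R}$ if for all $n,m$ $$\left|\frac{\gamma_{n+1}^m-\gamma_n^m}{a_n}\right|=1,\qquad \frac{\gamma_{n+1}^m-\gamma_n^m}{a_n}=R(K_n^m)\frac{\gamma_n^m-\gamma_{n-1}^m}{a_{n-1}},\qquad \frac{\gamma_n^{m+1}-\gamma_n^m}{b_m}=R(W_n^m)\frac{\gamma_{n+1}^m-\gamma_n^m}{a_n},$$ with $W_n^m=\frac{\Theta_n^{m+1}-\Theta_{n+1}^m}{2}$, $K_n^m=\frac{\Theta_{n+1}^m-\Theta_{n-1}^m}{2}$, and the potential is normalized so that the angle function is $\Psi_n^m=\frac{\Theta_{n+1}^m+\Theta_n^m}{2}$, i.e. $\frac{\gamma_{n+1}^m-\gamma_n^m}{a_n}={}^t(\cos\Psi_n^m,\sin\Psi_n^m)$. (Then $\Theta_n^m$ satisfies the discrete potential mKdV equation $\tan\frac{\Theta_{n+1}^{m+1}-\Theta_n^m}{4}=\frac{b_m+a_n}{b_m-a_n}\tan\frac{\Theta_n^{m+1}-\Theta_{n+1}^m}{4}$.) An equation $\tan\alpha=\frac{p+q}{p-q}\tan\beta$ with $p\ne q$ is understood in the cross-multiplied form $(p-q)\sin\alpha\cos\beta=(p+q)\cos\alpha\sin\beta$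 if a tangent is undefined. *)

theory Defs
  imports "HOL-Analysis.Analysis"
begin

definition rot :: "real \<Rightarrow> real^2^2" where
  "rot \<phi> = vector [vector [cos \<phi>, - sin \<phi>], vector [sin \<phi>, cos \<phi>]]"

definition refl_S :: "real^2^2" where
  "refl_S = vector [vector [1, 0], vector [0, -1]]"

(* Convention for lattice functions: the value with lower index n and upper index m is "f n m". *)

definition edge_dir :: "(int \<Rightarrow> real) \<Rightarrow> (int \<Rightarrow> int \<Rightarrow> real^2) \<Rightarrow> int \<Rightarrow> int \<Rightarrow> real^2" where
  "edge_dir a \<gamma> n m = (\<gamma> (n + 1) m - \<gamma> n m) /\<^sub>R a n"

definition angle_W :: "(int \<Rightarrow> int \<Rightarrow> real) \<Rightarrow> int \<Rightarrow> int \<Rightarrow> real" where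
  "angle_W \<Theta> n m = (\<Theta> n (m + 1) - \<Theta> (n + 1) m) / 2"

definition angle_K :: "(int \<Rightarrow> int \<Rightarrow> real) \<Rightarrow> int \<Rightarrow> int \<Rightarrow> real" where
  "angle_K \<Theta> n m = (\<Theta> (n + 1) m - \<Theta> (n - 1) m) / 2"

definition angle_Psi :: "(int \<Rightarrow> int \<Rightarrow> real) \<Rightarrow> int \<Rightarrow> int \<Rightarrow> real" where
  "angle_Psi \<Theta> n m = (\<Theta> (n + 1) m + \<Theta> n m) / 2"

(* The last conjunct is the normalization of the potential. The discrete potential mKdV
   equation is not part of the definition: it is a consequence of these conditions. *)
definition discrete_motion ::
  "(int \<Rightarrow> real) \<Rightarrow> (int \<Rightarrow> real) \<Rightarrow> (int \<Rightarrow> int \<Rightarrow> real^2) \<Rightarrow> (int \<Rightarrow> int \<Rightarrow> real) \<Rightarrow> bool" where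
  "discrete_motion a b \<gamma> \<Theta> \<longleftrightarrow>
     (\<forall>n m.
        norm (edge_dir a \<gamma> n m) = 1 \<and>
        edge_dir a \<gamma> n m = rot (angle_K \<Theta> n m) *v edge_dir a \<gamma> (n - 1) m \<and>
        (\<gamma> n (m + 1) - \<gamma> n m) /\<^sub>R b m = rot (angle_W \<Theta> n m) *v edge_dir a \<gamma> n m \<and>
        edge_dir a \<gamma> n m = vector [cos (angle_Psi \<Theta> n m), sin (angle_Psi \<Theta> n m)])"

(* The equation  tan \<alpha> = (p + q) / (p - q) * tan \<beta>  for p \<noteq> q, read in the cross-multiplied
   form when one of the two tangents is undefined (HOL's tan is total, with value 0 there). *)
definition tan_eq :: "real \<Rightarrow> real \<Rightarrow> real \<Rightarrow> real \<Rightarrow> bool" where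
  "tan_eq p q \<alpha> \<beta> \<longleftrightarrow>
     (if cos \<alpha> \<noteq> 0 \<and> cos \<beta> \<noteq> 0
      then tan \<alpha> = (p + q) / (p - q) * tan \<beta>
      else (p - q) * sin \<alpha> * cos \<beta> = (p + q) * cos \<alpha> * sin \<beta>)"

end

theory Submission
  imports Defs
begin

text \<open>
  Identify the plane with the complex numbers. The potential function encodes a discrete motion
  through the two symmetric difference equations
  \<open>\<gamma>\<^sub>n\<^sub>+\<^sub>1 - \<gamma>\<^sub>n = a\<^sub>n exp (i (\<Theta>\<^sub>n\<^sub>+\<^sub>1 + \<Theta>\<^sub>n) / 2)\<close> and, after cancelling \<open>\<Theta>\<^sub>n\<^sub>+\<^sub>1\<close> between \<open>W\<close> and
  \<open>\<Psi>\<close>, \<open>\<gamma>\<^sup>m\<^sup>+\<^sup>1 - \<gamma>\<^sup>m = b\<^sub>m exp (i (\<Theta>\<^sup>m\<^sup>+\<^sup>1 + \<Theta>\<^sup>m) / 2)\<close>. Likewise the transformed curve is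
  the conjugate of \<open>\<gamma> + exp (i (\<Theta> - \<Theta>') / 2) / \<lambda>\<close>. So each of the two directions reduces to the same
  trigonometric identity, and this identity factors through \<open>q sin (\<alpha> + \<beta>) = p sin (\<alpha> - \<beta>)\<close>,
  which is the cross-multiplied form of \<open>tan \<alpha> = (p + q) / (p - q) tan \<beta>\<close>.
\<close>

definition dir :: "real \<Rightarrow> real^2" where
  "dir x = vector [cos x, sin x]"

lemma dir_nth [simp]: "dir x $ 1 = cos x" "dir x $ 2 = sin x"
  by (simp_all add: dir_def)

lemma norm_dir [simp]: "norm (dir x) = 1"
  by (simp add: norm_vec_def L2_set_def sum_2)

lemma rot_dir: "rot x *v dir y = dir (x + y)"
  by (simp add: vec_eq_iff forall_2 rot_def matrix_vector_mult_def sum_2 cos_add sin_add)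

lemma refl_S_nth [simp]: "(refl_S *v v) $ 1 = v $ 1" "(refl_S *v v) $ 2 = - v $ 2"
  by (simp_all add: refl_S_def matrix_vector_mult_def sum_2)

text \<open>\<open>angle_K\<close> is the difference of consecutive values of
  \<open>angle_Psi\<close>, so the normalization carries the rotation along \<open>n\<close> and the
  unit norm.\<close>

lemma discrete_motion_iff:
  assumes "\<And>n. a n \<noteq> 0" and "\<And>m. b m \<noteq> 0"
  shows "discrete_motion a b \<gamma> \<Theta> \<longleftrightarrow>
    (\<forall>n m. \<gamma> (n + 1) m - \<gamma> n m = a n *\<^sub>R dir ((\<Theta> (n + 1) m + \<Theta> n m) / 2) \<and>
           \<gamma> n (m + 1) - \<gamma> n m = b m *\<^sub>R dir ((\<Theta> n (m + 1) + \<Theta> n m) / 2))"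
proof -
  have scale: "x /\<^sub>R c = y \<longleftrightarrow> x = c *\<^sub>R y" if "c \<noteq> 0" for c :: real and x y :: "real^2"
    using that by auto
  have K: "rot (angle_K \<Theta> n m) *v dir (angle_Psi \<Theta> (n - 1) m) = dir (angle_Psi \<Theta> n m)" for n m
    unfolding rot_dir by (rule arg_cong[of _ _ dir]) (simp add: angle_K_def angle_Psi_def field_simps)
  have W: "rot (angle_W \<Theta> n m) *v dir (angle_Psi \<Theta> n m) = dir ((\<Theta> n (m + 1) + \<Theta> n m) / 2)" for n m
    unfolding rot_dir by (rule arg_cong[of _ _ dir]) (simp add: angle_W_def angle_Psi_def field_simps)
  have "discrete_motion a b \<gamma> \<Theta> \<longleftrightarrow>
    (\<forall>n m. edge_dir a \<gamma> n m = dir (angle_Psi \<Theta> n m) \<and>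
           (\<gamma> n (m + 1) - \<gamma> n m) /\<^sub>R b m = dir ((\<Theta> n (m + 1) + \<Theta> n m) / 2))"
    unfolding discrete_motion_def dir_def[symmetric] using K W by (metis norm_dir)
  then show ?thesis
    using assms by (simp add: edge_dir_def scale angle_Psi_def)
qed

lemma tan_eq_imp_sin_eq:
  assumes "tan_eq p q \<alpha> \<beta>" and "p \<noteq> q"
  shows "q * sin (\<alpha> + \<beta>) = p * sin (\<alpha> - \<beta>)"
proof -
  have "(p - q) * sin \<alpha> * cos \<beta> = (p + q) * cos \<alpha> * sin \<beta>"
    using assms by (auto simp: tan_eq_def tan_def field_simps split: if_splits)
  then show ?thesis
    by (simp add: sin_add sin_diff algebra_simps)
qed

text \<open>\<open>A\<close>, \<open>B\<close> stand for \<open>\<Theta>\<close> and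
  \<open>C\<close>, \<open>D\<close> for \<open>\<Theta>'\<close> at the two ends of a lattice edge
  in either direction; \<open>p\<close> is \<open>1 / l\<close>.\<close>

lemma refl_S_increment:
  assumes "tan_eq p q ((D + A) / 4) ((C + B) / 4)" and "p \<noteq> q"
  shows "refl_S *v (q *\<^sub>R dir ((B + A) / 2) + p *\<^sub>R (dir ((B - D) / 2) - dir ((A - C) / 2)))
    = q *\<^sub>R dir ((D + C) / 2)"
proof -
  \<comment> \<open>With these half sums and differences, the two components of the claim differ
    from equality by \<open>2 * sin s\<close> and \<open>2 * cos s\<close> times
    \<open>q * sin u - p * sin v\<close>, up to sign.\<close>
  define s u v where "s = (A + B - C - D) / 4"
    and "u = (D + A) / 4 + (C + B) / 4" and "v = (D + A) / 4 - (C + B) / 4"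
  have angles: "(B + A) / 2 = s + u" "(B - D) / 2 = s - v" "(A - C) / 2 = s + v" "(D + C) / 2 = u - s"
    by (simp_all add: s_def u_def v_def field_simps)
  have "q * sin u = p * sin v"
    using tan_eq_imp_sin_eq[OF assms] by (simp add: u_def v_def)
  then show ?thesis
    unfolding angles vec_eq_iff forall_2
    by (auto simp: cos_add sin_add cos_diff sin_diff algebra_simps)
qed

theorem proposition4p9:
  fixes a b :: "int \<Rightarrow> real"
    and l :: real
    and \<gamma> \<gamma>' :: "int \<Rightarrow> int \<Rightarrow> real^2"
    and \<Theta> \<Theta>' :: "int \<Rightarrow> int \<Rightarrow> real"
  assumes "\<And>n. a n \<noteq> 0" and "\<And>m. b m \<noteq> 0"
    and "\<And>n m. a n \<noteq> b m"
    and "l \<noteq> 0" and "\<And>n. 1 / l \<noteq> a n" and "\<And>m. 1 / l \<noteq> b m"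
    and "discrete_motion a b \<gamma> \<Theta>"
    and "\<And>n m. tan_eq (1 / l) (a n)
                 ((\<Theta>' (n + 1) m + \<Theta> n m) / 4) ((\<Theta>' n m + \<Theta> (n + 1) m) / 4)"
    and "\<And>n m. tan_eq (1 / l) (b m)
                 ((\<Theta>' n (m + 1) + \<Theta> n m) / 4) ((\<Theta>' n m + \<Theta> n (m + 1)) / 4)"
    and "\<And>n m. \<gamma>' n m = refl_S *v
                 (\<gamma> n m + (1 / l) *\<^sub>R
                    (rot (- (\<Theta>' n m + \<Theta> (n + 1) m) / 2) *v
                      ((\<gamma> (n + 1) m - \<gamma> n m) /\<^sub>R a n)))"
  shows "discrete_motion a b \<gamma>' \<Theta>'"
proof -
  have motion: "\<gamma> (n + 1) m - \<gamma> n m = a n *\<^sub>R dir ((\<Theta> (n + 1) m + \<Theta> n m) / 2)"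
    "\<gamma> n (m + 1) - \<gamma> n m = b m *\<^sub>R dir ((\<Theta> n (m + 1) + \<Theta> n m) / 2)" for n m
    using assms(7) unfolding discrete_motion_iff[OF assms(1,2)] by blast+
  \<comment> \<open>\<open>\<Theta> (n + 1) m\<close> cancels, which leaves a formula that favours
    neither lattice direction.\<close>
  have \<gamma>': "\<gamma>' n m = refl_S *v (\<gamma> n m + (1 / l) *\<^sub>R dir ((\<Theta> n m - \<Theta>' n m) / 2))" for n m
  proof -
    have "- (\<Theta>' n m + \<Theta> (n + 1) m) / 2 + (\<Theta> (n + 1) m + \<Theta> n m) / 2 = (\<Theta> n m - \<Theta>' n m) / 2"
      by (simp add: field_simps)
    then have "rot (- (\<Theta>' n m + \<Theta> (n + 1) m) / 2) *v ((\<gamma> (n + 1) m - \<gamma> n m) /\<^sub>R a n)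
      = dir ((\<Theta> n m - \<Theta>' n m) / 2)"
      using assms(1) by (simp only: motion rot_dir scaleR_scaleR left_inverse scaleR_one not_False_eq_True)
    then show ?thesis
      by (simp only: assms(10))
  qed
  have increment: "\<gamma>' k j - \<gamma>' n m = q *\<^sub>R dir ((\<Theta>' k j + \<Theta>' n m) / 2)"
    if "\<gamma> k j - \<gamma> n m = q *\<^sub>R dir ((\<Theta> k j + \<Theta> n m) / 2)"
      and "tan_eq (1 / l) q ((\<Theta>' k j + \<Theta> n m) / 4) ((\<Theta>' n m + \<Theta> k j) / 4)" and "1 / l \<noteq> q"
    for k j n m q
    unfolding refl_S_increment[OF that(2,3), symmetric] that(1)[symmetric] \<gamma>'
    by (simp add: matrix_vector_mult_diff_distrib[symmetric] algebra_simps)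
  show ?thesis
    unfolding discrete_motion_iff[OF assms(1,2)]
    using increment[OF motion(1) assms(8) assms(5)] increment[OF motion(2) assms(9) assms(6)]
    by blast
qed

end
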